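(* Suppose that $K\subseteq 2^{[n]}$ is a flag simplicial complex, i.e. the clique complex of a graph with vertex set $[n]$. Then $$\frac{\epsilon(K)}{w(K)} \leq \frac{1}{6} = \frac{\epsilon([3]^{\ast 2k})}{w([3]^{\ast 2k})},$$ where the last equality holds for every integer $k\geq 1$.
   Context: Let $[n]=\{1,\dots,n\}$. A simplicial complex $K\subseteq 2^{S}$ on a finite set $S$ is a family of subsets of $S$ that contains $\emptyset$ and is closed under taking subsets. Partition number: $\pi(K)$ is the minimum integer $k$ such that for each partition $A_1\uplus\dots\uplus A_k=S$ (blocks may be empty) at least one of the sets $A_i$ is in $K$. Threshold characteristic: let $\Delta_S$ be the simplex of probability measures on $S$ (nonnegative weights $x_i$, $i\in S$, with $\sum x_i=1$, and $\mu(A)=\sum_{i\in A}x_i$). Put $T_{\mu\le\alpha}=\{A\subseteq S\mid \mu(A)\le\alpha\}$ and $T_{\mu<\alpha}=\{A\subseteq S\mid \mu(A)<\alpha\}$. Then $$\rho(K)=\sup\{\alpha\in[0,+\infty]\mid \exists\mu\in\Delta_S,\ T_{\mu\le\alpha}\subseteq K\}=\max\{\alpha\in[0,+\infty]\mid \exists\mu\in\Delta_S,\ T_{\mu<\alpha}\subseteq K\}.$$ Here $\rho(K)=+\infty$ iff $K=2^S$, and then $1/\rho(K)=0$. Non-linearity gap: $\epsilon(K)=\lfloor 1/\rho(K)\rfloor+1-\pi(K)$. The number $w(K)=|S|$ is the cardinality of the ground set. The clique complex of a graph $G$ on $[n]$ is the complex of all $A\subseteq[n]$ that are pairwise adjacent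 in $G$. The join of $K_1\subseteq 2^{S_1}$ and $K_2\subseteq 2^{S_2}$ is $K_1\ast K_2=\{A\uplus B\mid A\in K_1, B\in K_2\}\subseteq 2^{S_1\uplus S_2}$, and $K^{\ast m}$ is the join of $m$ copies of $K$. Viewed as a simplicial complex, $[3]$ is the $0$-dimensional complex $\{\emptyset,\{1\},\{2\},\{3\}\}\subset 2^{[3]}$ of three points. *)

theory Defs
  imports
    Complex_Main
    "HOL-Library.Ramsey"
    "HOL-Library.Disjoint_Sets"
    "HOL-Library.Extended_Nonnegative_Real"
begin

text \<open>A complex on a ground set \<open>S\<close> is a family \<open>K\<close> of subsets of \<open>S\<close>. All invariants take \<open>S\<close>
  explicitly, because not every element of \<open>S\<close> need be a vertex of \<open>K\<close>.\<close>

text \<open>The bound \<open>k \<ge> 1\<close> excludes the junk value \<open>0\<close>: a nonempty set has no partition into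
  \<open>0\<close> blocks, so the partition condition would hold vacuously there.\<close>

definition partition_number :: "'a set \<Rightarrow> 'a set set \<Rightarrow> nat" where
  "partition_number S K =
     (LEAST k. k \<ge> 1 \<and>
        (\<forall>A :: nat \<Rightarrow> 'a set.
           disjoint_family_on A {1..k} \<and> (\<Union>i\<in>{1..k}. A i) = S \<longrightarrow> (\<exists>i\<in>{1..k}. A i \<in> K)))"

definition prob_simplex :: "'a set \<Rightarrow> ('a \<Rightarrow> real) set" where
  "prob_simplex S = {x. (\<forall>i\<in>S. 0 \<le> x i) \<and> sum x S = 1}"

definition threshold_le :: "'a set \<Rightarrow> ('a \<Rightarrow> real) \<Rightarrow> ennreal \<Rightarrow> 'a set set" where
  "threshold_le S x \<alpha> = {A. A \<subseteq> S \<and> ennreal (sum x A) \<le> \<alpha>}"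

definition threshold_char :: "'a set \<Rightarrow> 'a set set \<Rightarrow> ennreal" where
  "threshold_char S K = Sup {\<alpha>. \<exists>x\<in>prob_simplex S. threshold_le S x \<alpha> \<subseteq> K}"

text \<open>In \<open>ennreal\<close>, \<open>1 / \<infinity> = 0\<close>, as required when \<open>K\<close> is the full power set. The quotient is finite
  for every complex on a nonempty finite ground set, so \<open>enn2real\<close> loses nothing.\<close>

definition nonlinearity_gap :: "'a set \<Rightarrow> 'a set set \<Rightarrow> int" where
  "nonlinearity_gap S K =
     \<lfloor>enn2real (1 / threshold_char S K)\<rfloor> + 1 - int (partition_number S K)"

definition clique_complex :: "'a set \<Rightarrow> 'a set set \<Rightarrow> 'a set set" where
  "clique_complex V E = {A. A \<subseteq> V \<and> clique A E}"

definition flag_complex :: "'a set \<Rightarrow> 'a set set \<Rightarrow> bool" where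
  "flag_complex V K \<longleftrightarrow> (\<exists>E. E \<subseteq> [V]\<^bsup>2\<^esup> \<and> K = clique_complex V E)"

text \<open>The join of a family of complexes \<open>K i\<close> on ground sets \<open>S i\<close> is a complex on the disjoint
  union \<open>Sigma I S\<close>; its faces are the disjoint unions of faces, one from each \<open>K i\<close>.
  The \<open>m\<close>-fold join of \<open>K\<close> with itself lives on \<open>{1..m} \<times> S\<close>.\<close>

definition join :: "'i set \<Rightarrow> ('i \<Rightarrow> 'a set set) \<Rightarrow> ('i \<times> 'a) set set" where
  "join I K = {Sigma I A | A. \<forall>i\<in>I. A i \<in> K i}"

definition join_power :: "nat \<Rightarrow> 'a set set \<Rightarrow> (nat \<times> 'a) set set" where
  "join_power m K = join {1..m} (\<lambda>_. K)"

definition three_points :: "nat set set" where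
  "three_points = {{}, {1}, {2}, {3}}"

end

theory Submission
  imports Defs
begin

text \<open>Let \<open>H\<close> be the graph of non-edges of a flag complex \<open>K\<close>. Then \<open>\<pi>(K)\<close> exceeds the matching
  number of \<open>H\<close> by one and \<open>1/\<rho>(K)\<close> is the fractional vertex cover number of \<open>H\<close>, so the gap compares
  the two. Koenig's theorem on the bipartite double cover of \<open>H\<close> yields a half-integral vertex cover of
  weight \<open>|M|/2\<close>, where \<open>M\<close> is a partial injection along edges of \<open>H\<close>. Its arcs form paths, even cycles
  and odd cycles; only an odd cycle loses weight \<open>1/2\<close> when one passes to disjoint edges, and it uses
  at least three vertices, which gives the loss of at most \<open>n/6\<close>. Disjoint triangles attain it.\<close>

section \<open>Koenig's theorem for finite relations\<close>

text \<open>\<open>X\<close> meets edges only on the left and \<open>Y\<close> only on the right, so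
  a relation on a single set is treated as its bipartite double cover. Finiteness is included
  because an infinite set has \<open>card\<close> 0 and would cover for free.\<close>

definition covers :: "('a \<times> 'b) set \<Rightarrow> 'a set \<Rightarrow> 'b set \<Rightarrow> bool" where
  "covers E X Y \<longleftrightarrow> finite X \<and> finite Y \<and> (\<forall>(a, b)\<in>E. a \<in> X \<or> b \<in> Y)"

lemma covers_converse: "covers (E\<inverse>) Y X \<longleftrightarrow> covers E X Y"
  unfolding covers_def by auto

text \<open>Uncrossing: if two critical edges share the vertex \<open>a\<close>, the covers of \<open>E\<close> minus either edge
  recombine into two covers of \<open>E\<close> whose total size is too small.\<close>

lemma critical_single_valued:
  assumes min: "\<And>X Y. covers E X Y \<Longrightarrow> t \<le> card X + card Y"
    and crit: "\<And>e. e \<in> E \<Longrightarrow> \<exists>X Y. covers (E - {e}) X Y \<and> card X + card Y < t"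
  shows "single_valued E"
proof (rule single_valuedI, rule ccontr)
  fix a b b'
  assume e: "(a, b) \<in> E" and e': "(a, b') \<in> E" and "b \<noteq> b'"
  obtain X Y where c: "covers (E - {(a, b)}) X Y" and lt: "card X + card Y < t"
    using crit[OF e] by blast
  obtain X' Y' where c': "covers (E - {(a, b')}) X' Y'" and lt': "card X' + card Y' < t"
    using crit[OF e'] by blast
  have fin: "finite X" "finite Y" "finite X'" "finite Y'"
    using c c' by (auto simp: covers_def)
  have notcov: "\<not> covers E X Y" "\<not> covers E X' Y'"
    using min lt lt' by (meson not_less)+
  then have a: "a \<notin> X" "a \<notin> X'"
    using c c' by (auto simp: covers_def)
  with c c' e e' \<open>b \<noteq> b'\<close> have b: "b \<in> Y'" "b' \<in> Y"
    by (auto simp: covers_def)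
  \<comment> \<open>An edge other than the two is covered by both pairs, hence by
    \<open>Y \<union> Y'\<close> on the right or by both \<open>X\<close> and \<open>X'\<close> on
    the left. The two removed edges end in \<open>b\<close> and \<open>b'\<close>.\<close>
  have "covers E (X \<inter> X') (Y \<union> Y')"
    using c c' b fin unfolding covers_def by auto
  from min[OF this] have 1: "t \<le> card (X \<inter> X') + card (Y \<union> Y')" .
  have "covers E (insert a (X \<union> X')) (Y \<inter> Y')"
    using c c' fin unfolding covers_def by auto
  from min[OF this] have 2: "t \<le> Suc (card (X \<union> X')) + card (Y \<inter> Y')"
    using a fin by simp
  \<comment> \<open>The sum of the two bounds is 2t \<le> |X| + |X'| + |Y| + |Y'| + 1, while both
    covers have size at most t - 1.\<close>
  show False
    using 1 2 lt lt' card_Un_Int[of X X'] card_Un_Int[of Y Y'] fin by linarith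
qed

text \<open>Let t be the least size of a cover. If no E - {e} has a matching with t edges, the
  induction hypothesis covers each E - {e} with fewer than t vertices. So every edge is critical,
  uncrossing from both sides makes \<open>E\<close> itself a matching, and its left endpoints cover
  it.\<close>

theorem koenig:
  assumes "finite E"
  shows "\<exists>M X Y. M \<subseteq> E \<and> single_valued M \<and> single_valued (M\<inverse>) \<and> covers E X Y \<and> card X + card Y \<le> card M"
  using assms
proof (induction E rule: finite_psubset_induct)
  case (psubset E)
  define t where "t = (LEAST t. \<exists>X Y. covers E X Y \<and> card X + card Y = t)"
  have "covers E (Domain E) {}"
    using psubset.hyps by (auto simp: covers_def finite_Domain)
  then have "\<exists>t X Y. covers E X Y \<and> card X + card Y = t" by blast
  then obtain X Y where XY: "covers E X Y" "card X + card Y = t"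
    unfolding t_def by (smt (verit, best) LeastI)
  have min: "t \<le> card X + card Y" if "covers E X Y" for X Y
    unfolding t_def using that by (blast intro: Least_le)
  show ?case
  proof (cases "\<exists>e\<in>E. \<exists>M\<subseteq>E - {e}. single_valued M \<and> single_valued (M\<inverse>) \<and> t \<le> card M")
    case True
    with XY show ?thesis by blast
  next
    case False
    have crit: "\<exists>X Y. covers (E - {e}) X Y \<and> card X + card Y < t" if "e \<in> E" for e
    proof -
      have "E - {e} \<subset> E" using that by blast
      from psubset.IH[OF this] False that show ?thesis
        by (meson le_trans not_le)
    qed
    have "single_valued E"
      using min crit by (rule critical_single_valued)
    moreover have "single_valued (E\<inverse>)"
    proof (rule critical_single_valued)
      show "t \<le> card Y + card X" if "covers (E\<inverse>) Y X" for X Y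
        using min[of X Y] that by (simp add: covers_converse)
      fix e assume "e \<in> E\<inverse>"
      then obtain a b where e: "e = (b, a)" "(a, b) \<in> E" by auto
      have "E\<inverse> - {e} = (E - {(a, b)})\<inverse>" using e by auto
      then show "\<exists>X Y. covers (E\<inverse> - {e}) X Y \<and> card X + card Y < t"
        using crit[OF e(2)] covers_converse by (metis add.commute)
    qed
    moreover have "card (Domain E) \<le> card E"
      using psubset.hyps by (simp add: Domain_fst card_image_le)
    ultimately show ?thesis
      using \<open>covers E (Domain E) {}\<close> by (intro exI[of _ E] exI[of _ "Domain E"] exI[of _ "{}"]) auto
  qed
qed

section \<open>Disjoint edges inside a partial injection\<close>

definition pair_set :: "'a \<times> 'a \<Rightarrow> 'a set" where
  "pair_set e = {fst e, snd e}"

text \<open>Either an initial edge of a path is peeled off, at a cost of at most 2 arcs, or \<open>M\<close> is a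
  permutation and one peels off a cycle of length 2 or 3, or the edges \<open>ab\<close> and \<open>cd\<close> of a stretch
  \<open>a, b, c, d\<close> of a longer cycle, at a cost of at most 5 arcs.\<close>

lemma peel_step:
  assumes inj: "single_valued M" "single_valued (M\<inverse>)" and irr: "irrefl M"
    and fin: "finite M" and ne: "M \<noteq> {}"
  shows "\<exists>W N. N \<subseteq> M \<and> N \<noteq> {} \<and> \<Union>(pair_set ` N) \<subseteq> W \<and> W \<subseteq> Field M
    \<and> pairwise (\<lambda>e f. disjnt (pair_set e) (pair_set f)) N
    \<and> 3 * card {e\<in>M. pair_set e \<inter> W \<noteq> {}} \<le> 6 * card N + card W"
proof -
  have sv: "(a, c) \<in> M \<longleftrightarrow> c = b" if "(a, b) \<in> M" for a b c
    using inj(1) that by (auto simp: single_valued_def)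
  have sv': "(c, a) \<in> M \<longleftrightarrow> c = b" if "(b, a) \<in> M" for a b c
    using inj(2) that by (auto simp: single_valued_def)
  have irr': "a \<noteq> b" if "(a, b) \<in> M" for a b
    using irr that by (auto simp: irrefl_def)
  have bound: "card A \<le> length xs" if "A \<subseteq> set xs" for A :: "('a \<times> 'a) set" and xs
    by (meson List.finite_set card_length card_mono le_trans that)
  show ?thesis
  proof (cases "Domain M \<subseteq> Range M")
    case False
    then obtain u v where uv: "(u, v) \<in> M" "u \<notin> Range M" by auto
    \<comment> \<open>The arc \<open>(u, v)\<close> starts a path: nothing enters \<open>u\<close>,
      so besides it only an arc leaving \<open>v\<close> can touch \<open>{u, v}\<close>.\<close>
    have "\<exists>w. {e\<in>M. pair_set e \<inter> {u, v} \<noteq> {}} \<subseteq> {(u, v), (v, w)}"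
    proof (cases "v \<in> Domain M")
      case True
      then obtain w where "(v, w) \<in> M" by auto
      note vw = this
      show ?thesis using uv(2)
        by (intro exI[of _ w])
          (auto simp: pair_set_def sv[OF uv(1)] sv'[OF uv(1)] sv[OF vw] sv'[OF vw])
    next
      case False
      then show ?thesis using uv by (intro exI[of _ v]) (auto simp: pair_set_def sv[OF uv(1)] sv'[OF uv(1)])
    qed
    then obtain w where "{e\<in>M. pair_set e \<inter> {u, v} \<noteq> {}} \<subseteq> set [(u, v), (v, w)]" by auto
    from bound[OF this] have "card {e\<in>M. pair_set e \<inter> {u, v} \<noteq> {}} \<le> 2" by simp
    then show ?thesis using uv
      by (intro exI[of _ "{u, v}"] exI[of _ "{(u, v)}"])
        (auto simp: pair_set_def Field_def pairwise_def)
  next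
    case True
    have fin': "finite (Range M)" using fin by (rule finite_Range)
    \<comment> \<open>Domain and range of a finite injection have equal size, so the inclusion is an
      equality and every vertex reached has a successor and a predecessor.\<close>
    have "card (Domain M) = card M"
      using inj(1) by (auto simp: Domain_fst intro!: card_image inj_onI dest: sv[THEN iffD1, rotated])
    moreover have "card (Range M) = card M"
      using inj(2) by (auto simp: Range_snd intro!: card_image inj_onI dest: sv'[THEN iffD1, rotated])
    ultimately have eq: "Domain M = Range M"
      using True fin' by (simp add: card_subset_eq)
    obtain a b where ab: "(a, b) \<in> M" using ne by auto
    then obtain z c where za: "(z, a) \<in> M" and bc: "(b, c) \<in> M" using eq by blast
    then obtain d where cd: "(c, d) \<in> M" using eq by blast
    then obtain e where de: "(d, e) \<in> M" using eq by blast
    note arcs = ab za bc cd de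
    note arcs_iff = arcs[THEN sv] arcs[THEN sv']
    note ne = arcs[THEN irr']
    consider "c = a" | "c \<noteq> a" "d = a" | "c \<noteq> a" "d \<noteq> a" by blast
    then show ?thesis
    proof cases
      case 1
      note ba = bc[unfolded 1]
      have "{e\<in>M. pair_set e \<inter> {a, b} \<noteq> {}} \<subseteq> set [(a, b), (b, a)]"
        by (auto simp: pair_set_def sv[OF ab] sv'[OF ab] sv[OF ba] sv'[OF ba])
      from bound[OF this] show ?thesis using arcs 1
        by (intro exI[of _ "{a, b}"] exI[of _ "{(a, b)}"])
          (auto simp: pair_set_def Field_def pairwise_def)
    next
      case 2
      note ca = cd[unfolded 2]
      \<comment> \<open>The triangle uses up the budget exactly, 3 * 3 = 6 * 1 + 3; all other cases
        leave slack.\<close>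
      have "{e\<in>M. pair_set e \<inter> {a, b, c} \<noteq> {}} \<subseteq> set [(a, b), (b, c), (c, a)]"
        by (auto simp: pair_set_def sv[OF ab] sv'[OF ab] sv[OF bc] sv'[OF bc] sv[OF ca] sv'[OF ca])
      from bound[OF this] show ?thesis using arcs 2 ne
        by (intro exI[of _ "{a, b, c}"] exI[of _ "{(a, b)}"])
          (auto simp: pair_set_def Field_def pairwise_def)
    next
      case 3
      have "d \<noteq> b" using sv'[OF cd, of a] 3 ab by auto
      \<comment> \<open>The cost is at most 15, against 6 * 2 + 4 = 16. In a 4-cycle the first and
        last arcs listed coincide, which is harmless since \<open>bound\<close> uses the length of
        the list.\<close>
      have "{e\<in>M. pair_set e \<inter> {a, b, c, d} \<noteq> {}} \<subseteq> set [(z, a), (a, b), (b, c), (c, d), (d, e)]"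
        by (auto simp: pair_set_def arcs_iff)
      from bound[OF this] have "card {e\<in>M. pair_set e \<inter> {a, b, c, d} \<noteq> {}} \<le> 5" by simp
      moreover have "card {a, b, c, d} = 4" using 3 ne \<open>d \<noteq> b\<close> by auto
      moreover have "card {(a, b), (c, d)} = 2" using 3 by auto
      moreover have "pairwise (\<lambda>e f. disjnt (pair_set e) (pair_set f)) {(a, b), (c, d)}"
        using 3 ne \<open>d \<noteq> b\<close> by (auto simp: pairwise_def pair_set_def disjnt_def)
      ultimately show ?thesis using arcs
        by (intro exI[of _ "{a, b, c, d}"] exI[of _ "{(a, b), (c, d)}"])
          (auto simp: pair_set_def Field_def)
    qed
  qed
qed

text \<open>Peeling is iterated. The sets \<open>W\<close> removed in successive rounds are
  disjoint, so each vertex of \<open>V\<close> is charged at most once and the inequalities of the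
  rounds add up.\<close>

lemma disjoint_arcs:
  assumes "single_valued M" "single_valued (M\<inverse>)" "irrefl M" "finite V" "Field M \<subseteq> V"
  shows "\<exists>N\<subseteq>M. pairwise (\<lambda>e f. disjnt (pair_set e) (pair_set f)) N \<and> 3 * card M \<le> 6 * card N + card V"
proof -
  have "finite M"
    using assms(4,5) by (intro finite_subset[of M "V \<times> V"]) (auto simp: Field_def)
  then show ?thesis using assms
  proof (induction M arbitrary: V rule: finite_psubset_induct)
    case (psubset M)
    show ?case
    proof (cases "M = {}")
      case True
      then show ?thesis by (intro exI[of _ "{}"]) simp
    next
      case False
      obtain W N where N: "N \<subseteq> M" "N \<noteq> {}" "\<Union>(pair_set ` N) \<subseteq> W" "W \<subseteq> Field M"
        and disj: "pairwise (\<lambda>e f. disjnt (pair_set e) (pair_set f)) N"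
        and le: "3 * card {e\<in>M. pair_set e \<inter> W \<noteq> {}} \<le> 6 * card N + card W"
        using peel_step[OF psubset.prems(1-3) psubset.hyps False] by blast
      \<comment> \<open>Dropping every arc that touches \<open>W\<close> moves the rest of the
        relation to \<open>V - W\<close> and keeps later choices disjoint from
        \<open>N\<close>.\<close>
      define M' where "M' = {e\<in>M. pair_set e \<inter> W = {}}"
      have "M' \<subset> M" using N unfolding M'_def pair_set_def by fastforce
      moreover have "single_valued M'" "single_valued (M'\<inverse>)" "irrefl M'"
        using psubset.prems(1-3) by (auto simp: M'_def single_valued_def irrefl_def)
      moreover have "finite (V - W)" using psubset.prems by simp
      moreover have "Field M' \<subseteq> V - W"
        using psubset.prems(5) by (fastforce simp: M'_def Field_def pair_set_def)
      ultimately obtain N' where N': "N' \<subseteq> M'" 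
        and disj': "pairwise (\<lambda>e f. disjnt (pair_set e) (pair_set f)) N'"
        and le': "3 * card M' \<le> 6 * card N' + card (V - W)"
        using psubset.IH by metis
      have "M = M' \<union> {e\<in>M. pair_set e \<inter> W \<noteq> {}}" "M' \<inter> {e\<in>M. pair_set e \<inter> W \<noteq> {}} = {}"
        by (auto simp: M'_def)
      then have cM: "card M = card M' + card {e\<in>M. pair_set e \<inter> W \<noteq> {}}"
        using psubset.hyps by (metis (no_types, lifting) card_Un_disjoint finite_Un)
      have WV: "W \<subseteq> V" using N(4) psubset.prems(5) by blast
      then have cV: "card V = card (V - W) + card W"
        using psubset.prems(4) by (metis card_Diff_subset card_mono finite_subset le_add_diff_inverse2)
      have cross: "disjnt (pair_set e) (pair_set f)" if "e \<in> N" "f \<in> N'" for e f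
        using that N(3) N'(1) by (fastforce simp: M'_def disjnt_def)
      have "N \<inter> N' = {}" using cross by (fastforce simp: disjnt_def pair_set_def)
      then have cN: "card (N \<union> N') = card N + card N'"
        using N(1) N' \<open>M' \<subset> M\<close> psubset.hyps by (meson card_Un_disjoint finite_subset psubset_imp_subset)
      have "pairwise (\<lambda>e f. disjnt (pair_set e) (pair_set f)) (N \<union> N')"
        using disj disj' cross disjnt_sym unfolding pairwise_def by (metis Un_iff)
      moreover have "N \<union> N' \<subseteq> M" using N(1) N' \<open>M' \<subset> M\<close> by blast
      ultimately show ?thesis
        using le le' cM cV cN by (intro exI[of _ "N \<union> N'"]) auto
    qed
  qed
qed

section \<open>Bounds for the partition number\<close>

definition every_partition_hits :: "'a set \<Rightarrow> 'a set set \<Rightarrow> nat \<Rightarrow> bool" where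
  "every_partition_hits S K k \<longleftrightarrow> k \<ge> 1 \<and>
        (\<forall>A :: nat \<Rightarrow> 'a set.
           disjoint_family_on A {1..k} \<and> (\<Union>i\<in>{1..k}. A i) = S \<longrightarrow> (\<exists>i\<in>{1..k}. A i \<in> K))"

lemma partition_number_eq: "partition_number S K = (LEAST k. every_partition_hits S K k)"
  unfolding partition_number_def every_partition_hits_def ..

lemma partition_number_le:
  "every_partition_hits S K k \<Longrightarrow> partition_number S K \<le> k"
  unfolding partition_number_eq by (rule Least_le)

text \<open>This provides a witness for \<open>LEAST\<close>: of |S| + 1 disjoint blocks one must be
  empty, and the empty set is a face.\<close>

lemma every_partition_hits_Suc_card:
  assumes "finite S" "{} \<in> K"
  shows "every_partition_hits S K (Suc (card S))"
  unfolding every_partition_hits_def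
proof (intro conjI allI impI)
  fix A :: "nat \<Rightarrow> 'a set"
  assume A: "disjoint_family_on A {1..Suc (card S)} \<and> (\<Union>i\<in>{1..Suc (card S)}. A i) = S"
  show "\<exists>i\<in>{1..Suc (card S)}. A i \<in> K"
  proof (rule ccontr)
    assume no: "\<not> ?thesis"
    have fin: "finite (A i)" if "i \<in> {1..Suc (card S)}" for i
      using A that assms(1) by (metis UN_upper finite_subset)
    have "A i \<noteq> {}" if "i \<in> {1..Suc (card S)}" for i
      using no that assms(2) by metis
    then have "1 \<le> card (A i)" if "i \<in> {1..Suc (card S)}" for i
      using that fin by (simp add: Suc_leI card_gt_0_iff)
    then have "(\<Sum>i\<in>{1..Suc (card S)}. 1) \<le> (\<Sum>i\<in>{1..Suc (card S)}. card (A i))"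
      by (intro sum_mono)
    also have "\<dots> = card (\<Union>i\<in>{1..Suc (card S)}. A i)"
      using A fin by (intro card_UN_disjoint[symmetric]) (auto simp: disjoint_family_on_def)
    also have "\<dots> = card S" using A by simp
    finally show False by simp
  qed
qed simp

text \<open>Disjoint nonfaces extend to a partition of \<open>S\<close> into nonfaces, since
  supersets of nonfaces are nonfaces. With k \<le> |I| this would contradict the defining property
  of k.\<close>

lemma partition_number_gt:
  assumes "finite S" "{} \<in> K" and down: "\<And>A B. A \<in> K \<Longrightarrow> B \<subseteq> A \<Longrightarrow> B \<in> K"
    and F: "finite I" "disjoint_family_on F I" "\<And>i. i \<in> I \<Longrightarrow> F i \<subseteq> S \<and> F i \<notin> K"
  shows "card I < partition_number S K"
proof (rule ccontr)
  define k where "k = partition_number S K"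
  assume "\<not> ?thesis"
  then have kI: "k \<le> card I" by (simp add: k_def)
  have hits: "every_partition_hits S K k"
    unfolding k_def partition_number_eq
    using every_partition_hits_Suc_card[OF assms(1,2)] by (rule LeastI)
  then have "k \<ge> 1" by (simp add: every_partition_hits_def)
  obtain g where g: "g ` {1..k} \<subseteq> I" "inj_on g {1..k}"
    using card_le_inj[of "{1..k}" I] kI F(1) by auto
  \<comment> \<open>Block \<open>k\<close> takes all that the other k - 1 sets leave, so the blocks
    exhaust \<open>S\<close>; by disjointness it still contains \<open>F (g k)\<close>.\<close>
  define A where "A i = (if i = k then S - (\<Union>j\<in>{1..<k}. F (g j)) else F (g i))" for i
  have disj: "F (g i) \<inter> F (g j) = {}" if "i \<in> {1..k}" "j \<in> {1..k}" "i \<noteq> j" for i j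
    using that g(1) inj_onD[OF g(2)] by (intro disjoint_family_onD[OF F(2)]) auto
  have FS: "F (g i) \<subseteq> S" "F (g i) \<notin> K" if "i \<in> {1..k}" for i
    using that g(1) F(3) by blast+
  have "disjoint_family_on A {1..k}"
    unfolding disjoint_family_on_def
  proof (intro ballI impI)
    fix i j assume ij: "i \<in> {1..k}" "j \<in> {1..k}" "i \<noteq> j"
    then have "i \<noteq> k \<Longrightarrow> i \<in> {1..<k}" "j \<noteq> k \<Longrightarrow> j \<in> {1..<k}" by auto
    then show "A i \<inter> A j = {}"
      using disj[OF ij] ij unfolding A_def by auto
  qed
  moreover have "(\<Union>i\<in>{1..k}. A i) = S"
  proof
    show "(\<Union>i\<in>{1..k}. A i) \<subseteq> S" using FS(1) by (fastforce simp: A_def split: if_splits)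
    show "S \<subseteq> (\<Union>i\<in>{1..k}. A i)"
    proof
      fix x assume "x \<in> S"
      show "x \<in> (\<Union>i\<in>{1..k}. A i)"
      proof (cases "x \<in> A k")
        case True
        then show ?thesis using \<open>k \<ge> 1\<close> by auto
      next
        case False
        then obtain j where "j \<in> {1..<k}" "x \<in> F (g j)" using \<open>x \<in> S\<close> by (auto simp: A_def)
        then show ?thesis by (intro UN_I[of j]) (auto simp: A_def)
      qed
    qed
  qed
  ultimately obtain i where i: "i \<in> {1..k}" "A i \<in> K"
    using hits unfolding every_partition_hits_def by blast
  have "F (g i) \<subseteq> A i"
    using disj[of i] FS(1)[OF i(1)] i(1) by (fastforce simp: A_def)
  then show False using down[OF i(2)] FS(2)[OF i(1)] by blast
qed

section \<open>Fractional covers bound the threshold characteristic\<close>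

lemma divide_left_mono_ennreal: "(a::ennreal) \<le> b \<Longrightarrow> c / b \<le> c / a"
  including ennreal.lifting
  unfolding divide_ennreal_def
  by (intro mult_left_mono) (transfer, auto intro!: ereal_inverse_antimono)

text \<open>The weight \<open>y\<close> is a fractional cover of the nonfaces. If its total t is
  positive, y / t is a probability measure giving each nonface at least 1/t, so the threshold
  characteristic is at least 1/t.\<close>

lemma inverse_threshold_char_le:
  assumes "finite S" "S \<noteq> {}" and y: "\<And>i. i \<in> S \<Longrightarrow> 0 \<le> y i"
    and nonface: "\<And>A. A \<subseteq> S \<Longrightarrow> A \<notin> K \<Longrightarrow> 1 \<le> sum y A"
  shows "1 / threshold_char S K \<le> ennreal (sum y S)"
proof -
  define t where "t = sum y S"
  have "t \<ge> 0" unfolding t_def using y by (simp add: sum_nonneg)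
  then consider "t = 0" | "t > 0" by linarith
  then show ?thesis
  proof cases
    case 1
    \<comment> \<open>Total weight 0 excludes nonfaces, so even an infinite threshold is admissible,
      with a point mass as measure.\<close>
    have K: "A \<in> K" if "A \<subseteq> S" for A
    proof (rule ccontr)
      assume "A \<notin> K"
      then have "1 \<le> sum y A" using nonface that by blast
      also have "\<dots> \<le> t" unfolding t_def using that assms(1) y by (intro sum_mono2) auto
      finally show False using 1 by simp
    qed
    obtain s where "s \<in> S" using assms(2) by blast
    then have "(\<lambda>i. if i = s then 1 else 0) \<in> prob_simplex S"
      using assms(1) by (simp add: prob_simplex_def)
    then have "top \<le> threshold_char S K"
      unfolding threshold_char_def using K by (intro Sup_upper) (auto simp: threshold_le_def)
    then show ?thesis by (simp add: top_unique)
  next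
    case 2
    have x: "(\<lambda>i. y i / t) \<in> prob_simplex S"
      using 2 y by (auto simp: prob_simplex_def t_def simp flip: sum_divide_distrib)
    \<comment> \<open>A nonface may have measure exactly 1/t, so only thresholds strictly below 1/t
      are admissible for certain; the supremum still reaches 1/t.\<close>
    have "ennreal (1 / t) \<le> threshold_char S K"
    proof (rule dense_le)
      fix \<alpha> assume \<alpha>: "\<alpha> < ennreal (1 / t)"
      have "threshold_le S (\<lambda>i. y i / t) \<alpha> \<subseteq> K"
      proof
        fix A assume A: "A \<in> threshold_le S (\<lambda>i. y i / t) \<alpha>"
        then have "ennreal (sum y A / t) < ennreal (1 / t)"
          using \<alpha> by (auto simp: threshold_le_def sum_divide_distrib)
        then have "sum y A / t < 1 / t"
          by (metis ennreal_leI linorder_not_less)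
        then have "sum y A < 1" using 2 by (simp add: divide_less_cancel)
        then show "A \<in> K" using nonface[of A] A by (force simp: threshold_le_def)
      qed
      then show "\<alpha> \<le> threshold_char S K"
        unfolding threshold_char_def using x by (intro Sup_upper) auto
    qed
    then have "1 / threshold_char S K \<le> 1 / ennreal (1 / t)"
      by (rule divide_left_mono_ennreal)
    also have "\<dots> = ennreal t"
      using 2 by (simp add: divide_ennreal flip: ennreal_1)
    finally show ?thesis by (simp add: t_def)
  qed
qed

section \<open>The gap of a flag complex\<close>

lemma clique_complex_down: "A \<in> clique_complex V E \<Longrightarrow> B \<subseteq> A \<Longrightarrow> B \<in> clique_complex V E"
  unfolding clique_complex_def clique_def by blast

lemma empty_in_clique_complex: "{} \<in> clique_complex V E"
  by (simp add: clique_complex_def clique_def)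

theorem flag_nonlinearity_gap_le:
  fixes S :: "'a set"
  assumes S: "finite S" "S \<noteq> {}" and flag: "flag_complex S K"
  shows "real_of_int (nonlinearity_gap S K) \<le> card S / 6"
proof -
  obtain E where K: "K = clique_complex S E" using flag by (auto simp: flag_complex_def)
  \<comment> \<open>Both orientations of every non-edge occur, so \<open>koenig\<close> is applied
    to the double cover of the complement graph.\<close>
  define R where "R = {(u, v). u \<in> S \<and> v \<in> S \<and> u \<noteq> v \<and> {u, v} \<notin> E}"
  have RS: "R \<subseteq> S \<times> S" by (auto simp: R_def)
  then have "finite R" using S by (meson finite_SigmaI finite_subset)
  then obtain M X Y where M: "M \<subseteq> R" "single_valued M" "single_valued (M\<inverse>)"
    and cov: "covers R X Y" and card: "card X + card Y \<le> card M"
    using koenig by metis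
  have "irrefl M" "Field M \<subseteq> S" using M(1) by (auto simp: R_def irrefl_def Field_def)
  then obtain N where N: "N \<subseteq> M" "pairwise (\<lambda>e f. disjnt (pair_set e) (pair_set f)) N"
    and le: "3 * card M \<le> 6 * card N + card S"
    using disjoint_arcs[OF M(2,3) _ S(1)] by metis
  have "card N < partition_number S K"
  proof (rule partition_number_gt)
    show "finite N" using N(1) M(1) \<open>finite R\<close> by (meson finite_subset)
    show "disjoint_family_on pair_set N"
      using N(2) by (auto simp: disjoint_family_on_def pairwise_def disjnt_def)
    show "pair_set e \<subseteq> S \<and> pair_set e \<notin> K" if "e \<in> N" for e
    proof -
      obtain u v where e: "e = (u, v)" by (cases e)
      with that N(1) M(1) have "u \<in> S" "v \<in> S" "u \<noteq> v" "{u, v} \<notin> E" by (auto simp: R_def)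
      then show ?thesis by (simp add: e K pair_set_def clique_complex_def clique_def)
    qed
  qed (auto simp: K empty_in_clique_complex S intro: clique_complex_down)
  \<comment> \<open>Averaging the two sides of the cover gives a fractional cover: for a non-edge
    uv, the arcs \<open>(u, v)\<close> and \<open>(v, u)\<close> are covered by different
    memberships, and each contributes 1/2.\<close>
  define y :: "'a \<Rightarrow> real" where "y v = (of_bool (v \<in> X) + of_bool (v \<in> Y)) / 2" for v
  have "1 / threshold_char S K \<le> ennreal (sum y S)"
  proof (rule inverse_threshold_char_le[OF S])
    fix A assume A: "A \<subseteq> S" "A \<notin> K"
    then obtain u v where uv: "u \<in> A" "v \<in> A" "u \<noteq> v" "{u, v} \<notin> E"
      by (auto simp: K clique_complex_def clique_def)
    then have "(u, v) \<in> R" "(v, u) \<in> R" using A by (auto simp: R_def insert_commute)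
    then have "1 \<le> sum y {u, v}"
      using cov uv(3) by (auto simp: covers_def y_def)
    also have "\<dots> \<le> sum y A"
      using uv A(1) S(1) by (intro sum_mono2) (auto simp: y_def intro: finite_subset)
    finally show "1 \<le> sum y A" .
  qed (simp add: y_def)
  then have le1: "enn2real (1 / threshold_char S K) \<le> sum y S"
    by (intro enn2real_leI sum_nonneg) (simp_all add: y_def)
  have "sum y S = (real (card (S \<inter> X)) + real (card (S \<inter> Y))) / 2"
    using S(1) by (simp add: y_def sum.distrib flip: sum_divide_distrib)
  also have "\<dots> \<le> (real (card X) + real (card Y)) / 2"
    using cov by (auto simp: covers_def intro!: divide_right_mono add_mono card_mono)
  also have "\<dots> \<le> real (card N) + card S / 6"
  proof -
    have "3 * (card X + card Y) \<le> 3 * card M" using card by simp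
    then have "3 * (card X + card Y) \<le> 6 * card N + card S" using le by (rule order_trans)
    from of_nat_mono[OF this, where ?'a = real] show ?thesis by simp
  qed
  \<comment> \<open>The strict bound \<open>card N < partition_number S K\<close> absorbs the + 1 in
    the gap.\<close>
  finally show ?thesis
    using le1 \<open>card N < partition_number S K\<close> of_int_floor_le[of "enn2real (1 / threshold_char S K)"]
    unfolding nonlinearity_gap_def by linarith
qed

section \<open>Joins of three points\<close>

lemma three_points_iff: "A \<in> three_points \<longleftrightarrow> A \<subseteq> {1..3} \<and> (\<forall>u\<in>A. \<forall>v\<in>A. u = v)"
proof -
  have "{1..3} = {1, 2, 3 :: nat}" by auto
  then show ?thesis unfolding three_points_def by auto
qed

lemma join_power_three_points_iff:
  "A \<in> join_power m three_points \<longleftrightarrow>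
     A \<subseteq> {1..m} \<times> {1..3} \<and> (\<forall>u\<in>A. \<forall>v\<in>A. fst u = fst v \<longrightarrow> u = v)"
proof
  assume "A \<in> join_power m three_points"
  then obtain B where "A = Sigma {1..m} B" "\<forall>i\<in>{1..m}. B i \<in> three_points"
    by (auto simp: join_power_def join_def)
  then show "A \<subseteq> {1..m} \<times> {1..3} \<and> (\<forall>u\<in>A. \<forall>v\<in>A. fst u = fst v \<longrightarrow> u = v)"
    unfolding three_points_iff by auto
next
  assume A: "A \<subseteq> {1..m} \<times> {1..3} \<and> (\<forall>u\<in>A. \<forall>v\<in>A. fst u = fst v \<longrightarrow> u = v)"
  have "A = Sigma {1..m} (\<lambda>i. {j. (i, j) \<in> A})" using A by auto
  moreover have "\<forall>i\<in>{1..m}. {j. (i, j) \<in> A} \<in> three_points"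
    unfolding three_points_iff
  proof (intro ballI conjI subsetI)
    fix i j assume "j \<in> {j. (i, j) \<in> A}"
    then show "j \<in> {1..3}" using A by blast
  next
    fix i u v assume "u \<in> {j. (i, j) \<in> A}" "v \<in> {j. (i, j) \<in> A}"
    then show "u = v" using A by fastforce
  qed
  ultimately show "A \<in> join_power m three_points"
    unfolding join_power_def join_def by blast
qed

text \<open>The graph is complete m-partite with parts of size 3; its complement consists of m
  disjoint triangles.\<close>

lemma flag_complex_join_power: "flag_complex ({1..m} \<times> {1..3}) (join_power m three_points)"
proof -
  define S where "S = {1..m} \<times> {1..3 :: nat}"
  define E where "E = {{u, v} | u v. u \<in> S \<and> v \<in> S \<and> fst u \<noteq> fst v}"
  have "E \<subseteq> [S]\<^bsup>2\<^esup>" by (auto simp: E_def nsets_def card_2_iff)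
  moreover have "{u, v} \<in> E \<longleftrightarrow> u \<in> S \<and> v \<in> S \<and> fst u \<noteq> fst v" for u v
  proof
    assume "{u, v} \<in> E"
    then obtain u' v' where "{u, v} = {u', v'}" "u' \<in> S" "v' \<in> S" "fst u' \<noteq> fst v'"
      unfolding E_def by blast
    then show "u \<in> S \<and> v \<in> S \<and> fst u \<noteq> fst v"
      by (elim doubleton_eq_iff[THEN iffD1, THEN disjE]) auto
  qed (unfold E_def, blast)
  then have "join_power m three_points = clique_complex S E"
    unfolding set_eq_iff join_power_three_points_iff S_def[symmetric] clique_complex_def clique_def
    by blast
  ultimately show ?thesis by (auto simp: flag_complex_def S_def)
qed

text \<open>A block that is a nonface contains two points of one triple. Two disjoint blocks cannot
  use the same triple, as that takes four points, so m triples cannot serve m + 1 blocks.\<close>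

lemma partition_number_join_power:
  "partition_number ({1..m} \<times> {1..3}) (join_power m three_points) \<le> m + 1"
proof (rule partition_number_le, unfold every_partition_hits_def, intro conjI allI impI)
  fix A :: "nat \<Rightarrow> (nat \<times> nat) set"
  assume A: "disjoint_family_on A {1..m + 1} \<and> (\<Union>i\<in>{1..m + 1}. A i) = {1..m} \<times> {1..3}"
  show "\<exists>i\<in>{1..m + 1}. A i \<in> join_power m three_points"
  proof (rule ccontr)
    assume no: "\<not> ?thesis"
    have "\<exists>p j j'. p \<in> {1..m} \<and> j \<noteq> j' \<and> (p, j) \<in> A i \<and> (p, j') \<in> A i" if i: "i \<in> {1..m + 1}" for i
    proof -
      have "A i \<subseteq> {1..m} \<times> {1..3}" using A i by blast
      moreover have "A i \<notin> join_power m three_points" using no i by blast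
      ultimately obtain u v where "u \<in> A i" "v \<in> A i" "fst u = fst v" "u \<noteq> v"
        unfolding join_power_three_points_iff by blast
      then show ?thesis using \<open>A i \<subseteq> _\<close>
        by (intro exI[of _ "fst u"] exI[of _ "snd u"] exI[of _ "snd v"]) (auto simp: prod_eq_iff)
    qed
    then obtain p j j' where p: "\<And>i. i \<in> {1..m + 1} \<Longrightarrow>
        p i \<in> {1..m} \<and> j i \<noteq> j' i \<and> (p i, j i) \<in> A i \<and> (p i, j' i) \<in> A i"
      by metis
    have "inj_on p {1..m + 1}"
    proof (rule inj_onI, rule ccontr)
      fix i l assume il: "i \<in> {1..m + 1}" "l \<in> {1..m + 1}" "p i = p l" "i \<noteq> l"
      then have disj: "A i \<inter> A l = {}" using A by (auto simp: disjoint_family_on_def)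
      have "{j i, j' i, j l, j' l} \<subseteq> {1..3}" using A p[OF il(1)] p[OF il(2)] il(1,2) by blast
      then have "card {j i, j' i, j l, j' l} \<le> 3"
        using card_mono[of "{1..3::nat}"] by fastforce
      moreover have "card {j i, j' i, j l, j' l} = 4"
      proof -
        have "j i \<noteq> j l" "j i \<noteq> j' l" "j' i \<noteq> j l" "j' i \<noteq> j' l"
          using p[OF il(1)] p[OF il(2)] il(3) disj by auto
        then show ?thesis using p[OF il(1)] p[OF il(2)] by simp
      qed
      ultimately show False by simp
    qed
    then have "card {1..m + 1} \<le> card {1..m}"
      using p by (intro card_inj_on_le) auto
    then show False by simp
  qed
qed simp

text \<open>Two points of one triple form a nonface, so above this threshold each such pair would
  weigh more than 2/(3m). The three pairs count each point twice, so each triple would exceed 1/m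
  and the total would exceed 1.\<close>

lemma threshold_char_join_power_le:
  assumes "m \<ge> 1"
  shows "threshold_char ({1..m} \<times> {1..3}) (join_power m three_points) \<le> ennreal (2 / (3 * real m))"
  unfolding threshold_char_def
proof (rule Sup_least, rule ccontr)
  fix \<alpha>
  assume "\<alpha> \<in> {\<alpha>. \<exists>x\<in>prob_simplex ({1..m} \<times> {1..3}).
      threshold_le ({1..m} \<times> {1..3}) x \<alpha> \<subseteq> join_power m three_points}"
    and "\<not> \<alpha> \<le> ennreal (2 / (3 * real m))"
  then obtain x where x: "x \<in> prob_simplex ({1..m} \<times> {1..3})"
    and sub: "threshold_le ({1..m} \<times> {1..3}) x \<alpha> \<subseteq> join_power m three_points"
    by blast
  have edge: "2 / (3 * real m) < x (i, a) + x (i, b)"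
    if "i \<in> {1..m}" "a \<in> {1..3}" "b \<in> {1..3}" "a \<noteq> b" for i a b
  proof (rule ccontr)
    assume "\<not> ?thesis"
    then have "ennreal (sum x {(i, a), (i, b)}) \<le> ennreal (2 / (3 * real m))"
      using that by (intro ennreal_leI) auto
    also have "\<dots> \<le> \<alpha>" using \<open>\<not> \<alpha> \<le> _\<close> by simp
    finally have "ennreal (sum x {(i, a), (i, b)}) \<le> \<alpha>" .
    then have "{(i, a), (i, b)} \<in> threshold_le ({1..m} \<times> {1..3}) x \<alpha>"
      using that(1-3) by (auto simp: threshold_le_def)
    then have "{(i, a), (i, b)} \<in> join_power m three_points" using sub by blast
    then show False using that(4) by (simp add: join_power_three_points_iff)
  qed
  have three: "{1..3} = {1, 2, 3 :: nat}" by auto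
  have "1 / m < (\<Sum>j\<in>{1..3}. x (i, j))" if "i \<in> {1..m}" for i
    using edge[OF that, of 1 2] edge[OF that, of 1 3] edge[OF that, of 2 3]
    unfolding three by (simp add: field_simps)
  then have "(\<Sum>i\<in>{1..m}. 1 / m) < (\<Sum>i\<in>{1..m}. \<Sum>j\<in>{1..3}. x (i, j))"
    using assms by (intro sum_strict_mono) auto
  also have "\<dots> = 1"
    using x by (simp add: prob_simplex_def sum.cartesian_product)
  finally show False using assms by simp
qed

text \<open>The upper bound is the flag inequality with |S| = 6k. Below, the gap is at least 3k + 1
  - (2k + 1); with an even number of copies the bound 3m/2 = 3k is an integer, so the floor loses
  nothing.\<close>

theorem nonlinearity_gap_join_power:
  assumes "k \<ge> 1"
  shows "nonlinearity_gap ({1..2 * k} \<times> {1..3}) (join_power (2 * k) three_points) = int k"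
proof (rule antisym)
  define S where "S = {1..2 * k} \<times> {1..3 :: nat}"
  define K where "K = join_power (2 * k) three_points"
  have S: "finite S" "S \<noteq> {}" "card S = 6 * k"
    using assms by (auto simp: S_def)
  have "real_of_int (nonlinearity_gap S K) \<le> k"
    using flag_nonlinearity_gap_le[OF S(1,2), of K] flag_complex_join_power[of "2 * k"] S(3)
    by (simp add: S_def K_def)
  then show "nonlinearity_gap S K \<le> int k" by linarith
  \<comment> \<open>The constant weight 1 serves only to show that the quotient is finite, since
    \<open>enn2real\<close> sends infinity to 0.\<close>
  have "1 / threshold_char S K \<le> ennreal (\<Sum>i\<in>S. 1)"
  proof (rule inverse_threshold_char_le[OF S(1,2)])
    fix A assume A: "A \<subseteq> S" "A \<notin> K"
    have "{} \<in> K" by (simp add: K_def join_power_three_points_iff)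
    then have "A \<noteq> {}" using A by blast
    moreover have "finite A" using A S by (meson finite_subset)
    ultimately show "1 \<le> (\<Sum>i\<in>A. 1 :: real)"
      by (simp add: Suc_leI card_gt_0_iff)
  qed simp
  then have fin: "1 / threshold_char S K < top"
    using ennreal_less_top le_less_trans by blast
  have "threshold_char S K \<le> ennreal (1 / (3 * real k))"
    using threshold_char_join_power_le[of "2 * k"] assms by (simp add: S_def K_def)
  then have "1 / ennreal (1 / (3 * real k)) \<le> 1 / threshold_char S K"
    by (rule divide_left_mono_ennreal)
  then have "ennreal (3 * real k) \<le> 1 / threshold_char S K"
    using assms by (simp add: divide_ennreal flip: ennreal_1)
  then have "3 * real k \<le> enn2real (1 / threshold_char S K)"
    using fin by (metis enn2real_ennreal enn2real_mono of_nat_0_le_iff of_nat_mult of_nat_numeral)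
  then have "3 * int k \<le> \<lfloor>enn2real (1 / threshold_char S K)\<rfloor>"
    by (simp add: le_floor_iff)
  then show "int k \<le> nonlinearity_gap S K"
    using partition_number_join_power[of "2 * k"]
    unfolding nonlinearity_gap_def S_def[symmetric] K_def[symmetric] by linarith
qed

theorem theorem1p6:
  shows "(\<forall>n::nat. \<forall>K :: nat set set. n \<ge> 1 \<and> flag_complex {1..n} K \<longrightarrow>
            real_of_int (nonlinearity_gap {1..n} K) / real (card {1..n}) \<le> 1 / 6) \<and>
         (\<forall>k::nat. k \<ge> 1 \<longrightarrow>
            (1 / 6 :: real) =
              real_of_int (nonlinearity_gap ({1..2 * k} \<times> {1..3}) (join_power (2 * k) three_points))
                / real (card ({1..2 * k} \<times> {1..3::nat})))"
proof (intro conjI allI impI)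
  fix n :: nat and K :: "nat set set"
  assume n: "n \<ge> 1 \<and> flag_complex {1..n} K"
  then have "real_of_int (nonlinearity_gap {1..n} K) \<le> card {1..n} / 6"
    by (intro flag_nonlinearity_gap_le) auto
  moreover have "real (card {1..n}) > 0" using n by simp
  ultimately show "real_of_int (nonlinearity_gap {1..n} K) / real (card {1..n}) \<le> 1 / 6"
    by (simp only: divide_le_eq) simp
next
  fix k :: nat
  assume "k \<ge> 1"
  then show "(1 / 6 :: real) =
      real_of_int (nonlinearity_gap ({1..2 * k} \<times> {1..3}) (join_power (2 * k) three_points))
        / real (card ({1..2 * k} \<times> {1..3::nat}))"
    unfolding nonlinearity_gap_join_power[OF \<open>k \<ge> 1\<close>] by simp
qed

end
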